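(* Let $X_1, X_2, \ldots$ be independent Poisson random variables with $\mathbb{E} X_k = 1/k$, let $S$ be the sumset of the multiset having $X_k$ copies of each positive integer $k$, and let $p_n := \mathbb{P}(n \in S)$. Let $$\eta := \frac{1 - \log 2 - \log(1/\log 2)}{\log 2} \approx -0.08607 .$$ Then $p_n = n^{\eta + o(1)}$ as $n \to \infty$.
   Context: $\log$ is the natural logarithm. The sumset is $S = \{ \sum_{k} a_k k : a_k \in \mathbb{Z}_{\ge 0},\ a_k \leq X_k \text{ for all } k,\ a_k=0 \text{ for all but finitely many } k\}$. *)

theory Defs
  imports "HOL-Probability.Probability"
begin

text \<open>
  A multiset of positive integers is given by its multiplicity function \<open>m\<close>, since it may be
  infinite and so need not be of type \<open>multiset\<close>. The value \<open>m 0\<close> plays no role.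
\<close>

definition sumset :: "(nat \<Rightarrow> nat) \<Rightarrow> nat set" where
  "sumset m = {\<Sum>k | 1 \<le> k \<and> a k \<noteq> 0. a k * k | a :: nat \<Rightarrow> nat.
     (\<forall>k\<ge>1. a k \<le> m k) \<and> finite {k. 1 \<le> k \<and> a k \<noteq> 0}}"

definition eta :: real where
  "eta = (1 - ln 2 - ln (1 / ln 2)) / ln 2"

end

theory Submission
  imports Defs "HOL-Analysis.Harmonic_Numbers" "HOL-Real_Asymp.Real_Asymp"
begin

text \<open>
  Upper bound. Let \<open>N = X\<^sub>1 + \<dots> + X\<^sub>n\<close>, let \<open>R\<close> be the number of representations of \<open>n\<close> as a sum of
  a subfamily of the parts, and \<open>K = log n / log 2\<close>, \<open>w = 1 / log 2\<close>, \<open>z = w / 2\<close>. If \<open>n\<close> is a sum,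
  then \<open>1 \<le> w^(N - K) + z^(N - K) R\<close>. Both terms have expectation \<open>O(n^\<eta>)\<close>, since
  \<open>E[w^N] = exp ((w - 1) H\<^sub>n)\<close> and \<open>E[z^N R] = exp ((z - 1) H\<^sub>n) [q^n] (1 - q)^(-z)\<close>.

  Lower bound. Restrict to \<open>X\<^sub>k \<in> {0, 1}\<close> and to part sets \<open>C \<union> {n - s}\<close>, where \<open>C\<close> has exactly \<open>t\<close>
  elements in each block \<open>[2^(ti), 2^(t(i+1)))\<close> below a constant times \<open>n\<close>, and \<open>s\<close> is a subset sum of
  \<open>C\<close>. The probability is then at least \<open>c n^(-2)\<close> times the sum of the numbers of subset sums of \<open>C\<close>,
  weighted by the products of \<open>1/k\<close>. As \<open>C\<close> never has more subset sums than the size of the next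
  element, adjoining an element essentially doubles their number on average, and each block
  contributes a factor \<open>(2 (t log 2 - 1))^t / t! = 2^(t (2 + \<eta> + o(1)))\<close> as \<open>t \<rightarrow> \<infinity>\<close>.
\<close>

subsection \<open>Upper bound\<close>

text \<open>Forcing \<open>a\<close> to vanish off \<open>{1..N}\<close> makes each representation a
  single function, so that the set is finite. The cutoff \<open>N\<close> is kept apart from
  \<open>n\<close> because the recurrence below varies \<open>n\<close> with \<open>N\<close>
  fixed.\<close>

definition parts :: "nat \<Rightarrow> nat \<Rightarrow> (nat \<Rightarrow> nat) set" where
  "parts N n = {a. (\<forall>k. k \<notin> {1..N} \<longrightarrow> a k = 0) \<and> (\<Sum>k = 1..N. a k * k) = n}"

lemma finite_parts: "finite (parts N n)"
proof (rule finite_subset)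
  show "parts N n \<subseteq> PiE_dflt {1..N} 0 (\<lambda>_. {..n})"
  proof
    fix a assume a: "a \<in> parts N n"
    have "a k \<le> n" if "k \<in> {1..N}" for k
    proof -
      have "a k \<le> a k * k" using that by simp
      also have "\<dots> \<le> (\<Sum>k = 1..N. a k * k)" using that by (intro member_le_sum) auto
      finally show ?thesis using a by (simp add: parts_def)
    qed
    with a show "a \<in> PiE_dflt {1..N} 0 (\<lambda>_. {..n})" by (auto simp: parts_def PiE_dflt_def)
  qed
  show "finite (PiE_dflt {1..N} (0 :: nat) (\<lambda>_. {..n}))" by (intro finite_PiE_dflt) auto
qed

text \<open>A part that occurs in a representation of \<open>n\<close> is at most \<open>n\<close>,
  so \<open>a\<close> may be truncated there. Membership thus depends on finitely many of the
  multiplicities.\<close>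

lemma mem_sumset_iff: "n \<in> sumset m \<longleftrightarrow> (\<exists>a\<in>parts n n. \<forall>k\<in>{1..n}. a k \<le> m k)"
proof
  assume "n \<in> sumset m"
  then obtain a where a: "\<forall>k\<ge>1. a k \<le> m k" "finite {k. 1 \<le> k \<and> a k \<noteq> 0}"
    and n: "n = (\<Sum>k | 1 \<le> k \<and> a k \<noteq> 0. a k * k)"
    by (auto simp: sumset_def)
  have le: "k \<le> n" if "1 \<le> k" "a k \<noteq> 0" for k
  proof -
    have "k \<le> a k * k" using that by simp
    also have "\<dots> \<le> n" unfolding n using that a(2)
      by (intro member_le_sum[where f = "\<lambda>k. a k * k"]) auto
    finally show ?thesis .
  qed
  define b where "b k = (if k \<in> {1..n} then a k else 0)" for k
  have "n = (\<Sum>k = 1..n. a k * k)"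
    by (subst n, rule sum.mono_neutral_left) (use le in auto)
  then have "b \<in> parts n n" by (simp add: parts_def b_def)
  then show "\<exists>a\<in>parts n n. \<forall>k\<in>{1..n}. a k \<le> m k"
    using a(1) by (intro bexI[of _ b]) (auto simp: b_def)
next
  assume "\<exists>a\<in>parts n n. \<forall>k\<in>{1..n}. a k \<le> m k"
  then obtain a where a: "\<And>k. k \<notin> {1..n} \<Longrightarrow> a k = 0" "(\<Sum>k = 1..n. a k * k) = n"
    "\<forall>k\<in>{1..n}. a k \<le> m k" by (auto simp: parts_def)
  have sub: "{k. 1 \<le> k \<and> a k \<noteq> 0} \<subseteq> {1..n}" using a(1) by force
  have "(\<Sum>k | 1 \<le> k \<and> a k \<noteq> 0. a k * k) = (\<Sum>k = 1..n. a k * k)"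
    by (rule sum.mono_neutral_left) (use sub in auto)
  moreover have "a k \<le> m k" if "k \<ge> 1" for k
    using a(1)[of k] a(3) that by (cases "k \<le> n") auto
  moreover have "finite {k. 1 \<le> k \<and> a k \<noteq> 0}" using sub by (rule finite_subset) simp
  ultimately show "n \<in> sumset m"
    unfolding sumset_def using a(2) by fastforce
qed

text \<open>For \<open>a\<close> in \<open>parts n n\<close> and \<open>z = 1\<close> this is
  Cauchy's formula for the proportion of permutations of \<open>n\<close> points with
  \<open>a k\<close> cycles of each length \<open>k\<close>; \<open>z\<close> marks the number of
  cycles.\<close>

definition cycle_weight :: "nat \<Rightarrow> real \<Rightarrow> (nat \<Rightarrow> nat) \<Rightarrow> real" where
  "cycle_weight N z a = (\<Prod>k = 1..N. (z / real k) ^ a k / fact (a k))"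

text \<open>The sum over \<open>parts N n\<close> is the coefficient of \<open>q^n\<close> in \<open>exp (z * (\<Sum>k. q^k / k)) = (1 - q)^(-z)\<close>;
  the recurrence is the logarithmic derivative of this series.\<close>

lemma sum_cycle_weight_rec:
  assumes "n \<le> N"
  shows "real n * (\<Sum>a\<in>parts N n. cycle_weight N z a) =
    z * (\<Sum>i<n. \<Sum>a\<in>parts N i. cycle_weight N z a)"
proof -
  define w where "w = cycle_weight N z"
  \<comment> \<open>Deleting one copy of \<open>k\<close> is a bijection from the representations of
    \<open>n\<close> containing \<open>k\<close> to those of \<open>n - k\<close>. It changes only
    the factor at \<open>k\<close>, where \<open>k * a k * (z / k) ^ a k / fact (a k)\<close> is
    \<open>z\<close> times the factor for \<open>a k - 1\<close>.\<close>
  have shift: "(\<Sum>a\<in>parts N n. real (k * a k) * w a) =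
      (if k \<le> n then z * (\<Sum>a\<in>parts N (n - k). w a) else 0)"
    if k: "k \<in> {1..N}" for k
  proof -
    let ?P = "{a \<in> parts N n. a k > 0}"
    have eq: "(\<Sum>a\<in>parts N n. real (k * a k) * w a) = (\<Sum>a\<in>?P. real (k * a k) * w a)"
      by (rule sum.mono_neutral_right) (use finite_parts in auto)
    have tot: "(\<Sum>j = 1..N. a j * j) = a k * k + (\<Sum>j\<in>{1..N} - {k}. a j * j)" for a :: "nat \<Rightarrow> nat"
      using k by (subst sum.remove[of _ k]) auto
    show ?thesis
    proof (cases "k \<le> n")
      case True
      have "(\<Sum>a\<in>?P. real (k * a k) * w a) = (\<Sum>a\<in>parts N (n - k). z * w a)"
      proof (rule sum.reindex_bij_witness[where j = "\<lambda>a. a(k := a k - 1)"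
            and i = "\<lambda>a. a(k := a k + 1)"])
        fix a assume a: "a \<in> ?P"
        have le: "k \<le> a k * k" using a by simp
        show "a(k := a k - 1) \<in> parts N (n - k)"
          using a k le tot[of a] tot[of "a(k := a k - 1)"]
          by (auto simp: parts_def diff_mult_distrib)
        have w: "w a = (z / real k) ^ a k / fact (a k) *
            (\<Prod>j\<in>{1..N} - {k}. (z / real j) ^ a j / fact (a j))"
          unfolding w_def cycle_weight_def using k by (subst prod.remove[of _ k]) auto
        have w': "w (a(k := a k - 1)) = (z / real k) ^ (a k - 1) / fact (a k - 1) *
            (\<Prod>j\<in>{1..N} - {k}. (z / real j) ^ a j / fact (a j))"
          unfolding w_def cycle_weight_def using k by (subst prod.remove[of _ k]) auto
        have "real (k * a k) * ((z / real k) ^ a k / fact (a k)) =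
            z * ((z / real k) ^ (a k - 1) / fact (a k - 1))"
          using a k by (cases "a k") (simp_all add: divide_simps, simp_all add: algebra_simps)
        moreover have "z * (u' * v) = c * (u * v)" if "c * u = z * u'" for c u u' v :: real
          using that by (simp only: mult.assoc[symmetric])
        ultimately show "z * w (a(k := a k - 1)) = real (k * a k) * w a"
          unfolding w w' by blast
      next
        fix a assume a: "a \<in> parts N (n - k)"
        show "a(k := a k + 1) \<in> ?P"
          using a k tot[of a] tot[of "a(k := a k + 1)"] True
          by (auto simp: parts_def)
      qed auto
      then show ?thesis using True eq by (simp add: sum_distrib_left)
    next
      case False
      have "?P = {}"
      proof (rule ccontr)
        assume "?P \<noteq> {}"
        then obtain a where a: "a \<in> parts N n" "a k > 0" by auto
        have "k \<le> a k * k" using a by simp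
        also have "\<dots> \<le> n" using a tot[of a] by (simp add: parts_def)
        finally show False using False by simp
      qed
      then show ?thesis using False eq by (simp only: sum.empty if_False)
    qed
  qed
  have "real n * (\<Sum>a\<in>parts N n. w a) = (\<Sum>a\<in>parts N n. real (\<Sum>k = 1..N. a k * k) * w a)"
    unfolding sum_distrib_left by (rule sum.cong) (auto simp: parts_def)
  also have "\<dots> = (\<Sum>a\<in>parts N n. \<Sum>k = 1..N. real (k * a k) * w a)"
    by (simp only: of_nat_sum sum_distrib_right) (simp add: mult.commute)
  also have "\<dots> = (\<Sum>k = 1..N. \<Sum>a\<in>parts N n. real (k * a k) * w a)"
    by (rule sum.swap)
  also have "\<dots> = (\<Sum>k = 1..N. if k \<le> n then z * (\<Sum>a\<in>parts N (n - k). w a) else 0)"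
    using shift by simp
  \<comment> \<open>Terms with \<open>k > n\<close> vanish, and \<open>n \<le> N\<close> ensures
    that no index up to \<open>n\<close> is missing.\<close>
  also have "\<dots> = (\<Sum>k = 1..n. z * (\<Sum>a\<in>parts N (n - k). w a))"
    using assms by (intro sum.mono_neutral_cong_right) auto
  also have "\<dots> = (\<Sum>i<n. z * (\<Sum>a\<in>parts N i. w a))"
    by (rule sum.reindex_bij_witness[where j = "\<lambda>k. n - k" and i = "\<lambda>k. n - k"]) auto
  finally show ?thesis by (simp add: w_def sum_distrib_left)
qed

text \<open>Comparing the recurrence at \<open>n\<close> and \<open>n + 1\<close> leaves a one-step
  relation: \<open>n + 1\<close> times the new coefficient is \<open>n + z\<close> times the old
  one.\<close>

lemma sum_cycle_weight_eq:
  assumes "n \<le> N"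
  shows "(\<Sum>a\<in>parts N n. cycle_weight N z a) = (\<Prod>i = 1..n. 1 + (z - 1) / real i)"
  using assms
proof (induction n)
  case 0
  have "parts N 0 = {\<lambda>_. 0}"
  proof (intro equalityI subsetI)
    fix a assume a: "a \<in> parts N 0"
    have "a k = 0" for k
      using a by (cases "k \<in> {1..N}") (auto simp: parts_def)
    then show "a \<in> {\<lambda>_. 0}" by auto
  qed (simp add: parts_def)
  then show ?case by (simp add: cycle_weight_def)
next
  case (Suc n)
  define c where "c i = (\<Sum>a\<in>parts N i. cycle_weight N z a)" for i
  have "real (Suc n) * c (Suc n) = z * (\<Sum>i<n. c i) + z * c n"
    using sum_cycle_weight_rec[OF Suc.prems, of z] by (simp add: c_def algebra_simps)
  also have "\<dots> = (real n + z) * c n"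
    using sum_cycle_weight_rec[of n N z] Suc.prems by (simp add: c_def algebra_simps)
  finally have "c (Suc n) = c n * (1 + (z - 1) / real (Suc n))"
    by (simp add: field_simps)
  then show ?case using Suc by (simp add: c_def)
qed

text \<open>Apply \<open>1 + x \<le> exp x\<close> to each factor; \<open>z \<ge> 0\<close> keeps
  the factors nonnegative, the critical one being \<open>i = 1\<close>.\<close>

lemma sum_cycle_weight_le:
  assumes "n \<le> N" "z \<ge> 0"
  shows "(\<Sum>a\<in>parts N n. cycle_weight N z a) \<le> exp ((z - 1) * harm n)"
proof -
  have "(\<Prod>i = 1..n. 1 + (z - 1) / real i) \<le> (\<Prod>i = 1..n. exp ((z - 1) / real i))"
  proof (intro prod_mono conjI)
    fix i assume "i \<in> {1..n}"
    then show "0 \<le> 1 + (z - 1) / real i" using assms(2) by (simp add: field_simps)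
    show "1 + (z - 1) / real i \<le> exp ((z - 1) / real i)" by (rule exp_ge_add_one_self)
  qed
  also have "\<dots> = exp ((z - 1) * harm n)"
    by (simp add: exp_sum[symmetric] harm_def sum_distrib_left divide_inverse)
  finally show ?thesis using sum_cycle_weight_eq[OF assms(1), of z] by simp
qed

text \<open>The first \<open>a\<close> terms vanish, and shifting the index by \<open>a\<close>
  leaves an exponential series. The binomial coefficient counts the ways to pick \<open>a\<close> of
  the \<open>x\<close> copies of a part, while \<open>z ^ x\<close> tilts by the number of
  copies.\<close>

lemma nn_integral_poisson_power_choose:
  assumes "l > 0" "z \<ge> 0"
  shows "(\<integral>\<^sup>+x. ennreal (z ^ x * real (x choose a)) \<partial>measure_pmf (poisson_pmf l)) =
    ennreal (exp ((z - 1) * l) * ((z * l) ^ a / fact a))"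
proof -
  define f where "f x = pmf (poisson_pmf l) x * (z ^ x * real (x choose a))" for x
  have f_nonneg: "f x \<ge> 0" for x using assms by (simp add: f_def)
  have shift: "f (b + a) = exp (- l) * (z * l) ^ a / fact a * ((z * l) ^ b /\<^sub>R fact b)" for b
  proof -
    have "real (b + a choose a) / fact (b + a) = 1 / (fact a * fact b)"
      by (subst binomial_fact) auto
    moreover have "f (b + a) = exp (- l) * (z * l) ^ (b + a) * (real (b + a choose a) / fact (b + a))"
      using assms by (simp add: f_def power_mult_distrib)
    ultimately have "f (b + a) = exp (- l) * (z * l) ^ (b + a) * (1 / (fact a * fact b))" by simp
    then show ?thesis by (simp add: power_add divide_simps)
  qed
  have "(\<lambda>b. f (b + a)) sums (exp (- l) * (z * l) ^ a / fact a * exp (z * l))"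
    unfolding shift by (intro sums_mult exp_converges)
  then have "f sums (exp (- l) * (z * l) ^ a / fact a * exp (z * l) + (\<Sum>i<a. f i))"
    by (simp add: sums_iff_shift)
  also have "(\<Sum>i<a. f i) = 0" by (intro sum.neutral) (simp add: f_def)
  also have "exp (- l) * (z * l) ^ a / fact a * exp (z * l) + 0 =
      exp ((z - 1) * l) * ((z * l) ^ a / fact a)"
    by (simp add: algebra_simps exp_diff exp_minus divide_simps)
  finally have sums: "f sums (exp ((z - 1) * l) * ((z * l) ^ a / fact a))" .
  have "(\<integral>\<^sup>+x. ennreal (z ^ x * real (x choose a)) \<partial>measure_pmf (poisson_pmf l)) =
      (\<integral>\<^sup>+x. ennreal (f x) \<partial>count_space UNIV)"
    unfolding nn_integral_measure_pmf f_def by (simp only: ennreal_mult' pmf_nonneg)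
  also have "\<dots> = (\<Sum>x. ennreal (f x))" by (rule nn_integral_count_space_nat)
  also have "\<dots> = ennreal (exp ((z - 1) * l) * ((z * l) ^ a / fact a))"
    using sums f_nonneg by (intro suminf_ennreal_eq)
  finally show ?thesis .
qed

section \<open>Exponential-moment bounds in the Poisson model\<close>

context prob_space
begin

text \<open>Independence reduces the claim to one variable. With \<open>a\<close> zero this is the
  generating function of the number of parts; summed over \<open>parts n n\<close> it also counts
  the representations of \<open>n\<close>.\<close>

lemma nn_integral_prod_poisson:
  fixes X :: "nat \<Rightarrow> 'a \<Rightarrow> nat" and z :: real and a :: "nat \<Rightarrow> nat"
  assumes indep: "indep_vars (\<lambda>_. count_space UNIV) X {1..}"
    and distr: "\<And>k. k \<ge> 1 \<Longrightarrow>
      distr M (count_space UNIV) (X k) = measure_pmf (poisson_pmf (1 / real k))"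
    and "z \<ge> 0"
  shows "(\<integral>\<^sup>+\<omega>. (\<Prod>k = 1..n. ennreal (z ^ X k \<omega> * real (X k \<omega> choose a k))) \<partial>M) =
    ennreal (exp ((z - 1) * harm n) * cycle_weight n z a)"
proof -
  define g where "g k x = ennreal (z ^ x * real (x choose a k))" for k x :: nat
  have "indep_vars (\<lambda>_. borel) (\<lambda>k \<omega>. g k (X k \<omega>)) {1..n}"
    by (rule indep_vars_compose2[OF indep_vars_subset[OF indep]]) auto
  then have "(\<integral>\<^sup>+\<omega>. (\<Prod>k = 1..n. g k (X k \<omega>)) \<partial>M) = (\<Prod>k = 1..n. \<integral>\<^sup>+\<omega>. g k (X k \<omega>) \<partial>M)"
    by (intro indep_vars_nn_integral) auto
  also have "\<dots> = (\<Prod>k = 1..n. ennreal (exp ((z - 1) / real k) * ((z / real k) ^ a k / fact (a k))))"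
  proof (rule prod.cong[OF refl])
    fix k assume k: "k \<in> {1..n}"
    have X: "X k \<in> measurable M (count_space UNIV)"
      using indep k by (auto simp: indep_vars_def)
    have "(\<integral>\<^sup>+\<omega>. g k (X k \<omega>) \<partial>M) = (\<integral>\<^sup>+x. g k x \<partial>distr M (count_space UNIV) (X k))"
      using X by (simp add: nn_integral_distr)
    also have "\<dots> = (\<integral>\<^sup>+x. g k x \<partial>measure_pmf (poisson_pmf (1 / real k)))"
      using distr k by simp
    also have "\<dots> = ennreal (exp ((z - 1) / real k) * ((z / real k) ^ a k / fact (a k)))"
      unfolding g_def using k \<open>z \<ge> 0\<close> by (subst nn_integral_poisson_power_choose) auto
    finally show "(\<integral>\<^sup>+\<omega>. g k (X k \<omega>) \<partial>M) = \<dots>" .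
  qed
  also have "\<dots> = ennreal (\<Prod>k = 1..n. exp ((z - 1) / real k) * ((z / real k) ^ a k / fact (a k)))"
    using \<open>z \<ge> 0\<close> by (intro prod_ennreal) auto
  also have "(\<Prod>k = 1..n. exp ((z - 1) / real k) * ((z / real k) ^ a k / fact (a k))) =
      exp ((z - 1) * harm n) * cycle_weight n z a"
    by (simp add: prod.distrib exp_sum[symmetric] harm_def sum_distrib_left divide_inverse
        cycle_weight_def)
  finally show ?thesis unfolding g_def .
qed

lemma sumset_event_measurable:
  fixes X :: "nat \<Rightarrow> 'a \<Rightarrow> nat"
  assumes "\<And>k. k \<ge> 1 \<Longrightarrow> random_variable (count_space UNIV) (X k)"
  shows "{\<omega> \<in> space M. n \<in> sumset (\<lambda>k. X k \<omega>)} \<in> events"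
proof -
  have "{\<omega> \<in> space M. n \<in> sumset (\<lambda>k. X k \<omega>)} =
      (\<Union>a\<in>parts n n. {\<omega> \<in> space M. \<forall>k\<in>{1..n}. a k \<le> X k \<omega>})"
    by (auto simp: mem_sumset_iff)
  also have "\<dots> \<in> events"
  proof (intro sets.finite_UN finite_parts sets.sets_Collect_finite_All)
    fix a k assume "k \<in> {1..n}"
    then have [measurable]: "random_variable (count_space UNIV) (X k)" using assms by simp
    show "{\<omega> \<in> space M. a k \<le> X k \<omega>} \<in> events" by measurable
  qed auto
  finally show ?thesis .
qed

text \<open>The threshold \<open>K\<close> on the number of parts is free here. In the second term
  one factor \<open>exp ((z - 1) * harm n)\<close> comes from the Poisson expectation and the other
  from bounding the sum of \<open>cycle_weight\<close>.\<close>

lemma prob_sumset_le: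
  fixes X :: "nat \<Rightarrow> 'a \<Rightarrow> nat" and w z K :: real
  assumes indep: "indep_vars (\<lambda>_. count_space UNIV) X {1..}"
    and distr: "\<And>k. k \<ge> 1 \<Longrightarrow>
      distr M (count_space UNIV) (X k) = measure_pmf (poisson_pmf (1 / real k))"
    and w: "w \<ge> 1" and z: "0 < z" "z \<le> 1"
  shows "prob {\<omega> \<in> space M. n \<in> sumset (\<lambda>k. X k \<omega>)} \<le>
    w powr (- K) * exp ((w - 1) * harm n) + z powr (- K) * exp (2 * (z - 1) * harm n)"
proof -
  define F where "F z a \<omega> = (\<Prod>k = 1..n. ennreal (z ^ X k \<omega> * real (X k \<omega> choose a k)))"
    for z :: real and a \<omega>
  have X: "random_variable (count_space UNIV) (X k)" if "k \<ge> 1" for k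
    using indep that by (auto simp: indep_vars_def)
  have meas: "F z a \<in> borel_measurable M" for z a
    unfolding F_def
  proof (intro borel_measurable_prod_ennreal)
    fix k assume "k \<in> {1..n}"
    then have [measurable]: "random_variable (count_space UNIV) (X k)" using X by simp
    show "(\<lambda>\<omega>. ennreal (z ^ X k \<omega> * real (X k \<omega> choose a k))) \<in> borel_measurable M"
      by measurable
  qed
  define E where "E = {\<omega> \<in> space M. n \<in> sumset (\<lambda>k. X k \<omega>)}"
  have E: "E \<in> events" unfolding E_def using X by (rule sumset_event_measurable)
  \<comment> \<open>With at least \<open>K\<close> parts the first term is already at least 1. With
    fewer, \<open>z \<le> 1\<close> makes \<open>z powr (S - K)\<close> at least 1, and one
    representation contributes a product of binomials that is at least 1.\<close>
  have bound: "indicator E \<omega> \<le> ennreal (w powr (- K)) * F w (\<lambda>_. 0) \<omega> +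
      ennreal (z powr (- K)) * (\<Sum>a\<in>parts n n. F z a \<omega>)" for \<omega>
  proof (cases "\<omega> \<in> E")
    case True
    define S where "S = (\<Sum>k = 1..n. X k \<omega>)"
    obtain a where a: "a \<in> parts n n" "\<And>k. k \<in> {1..n} \<Longrightarrow> a k \<le> X k \<omega>"
      using True by (auto simp: E_def mem_sumset_iff)
    have F: "F x b \<omega> = ennreal (x ^ S * (\<Prod>k = 1..n. real (X k \<omega> choose b k)))" if "x > 0" for x b
      unfolding F_def S_def using that
      by (subst prod_ennreal) (auto simp: prod.distrib power_sum)
    show ?thesis
    proof (cases "real S \<ge> K")
      case True
      have "1 \<le> w powr (real S - K)" using w True by (simp add: ge_one_powr_ge_zero)
      also have "\<dots> = w powr (- K) * w ^ S"
        using w by (simp add: powr_diff powr_minus powr_realpow field_simps)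
      finally have "1 \<le> ennreal (w powr (- K) * w ^ S)" by simp
      also have "\<dots> = ennreal (w powr (- K)) * F w (\<lambda>_. 0) \<omega>"
        using F[of w "\<lambda>_. 0"] w by (simp add: ennreal_mult')
      finally show ?thesis using \<open>\<omega> \<in> E\<close> by (simp add: add_increasing2)
    next
      case False
      have "1 \<le> (1 / z) powr (K - real S)" using z False by (intro ge_one_powr_ge_zero) auto
      also have "\<dots> = z powr (- K) * z ^ S"
        using z by (simp add: powr_divide powr_diff powr_minus powr_realpow field_simps)
      also have "\<dots> \<le> z powr (- K) * (z ^ S * (\<Prod>k = 1..n. real (X k \<omega> choose a k)))"
      proof -
        have "1 \<le> (\<Prod>k = 1..n. real (X k \<omega> choose a k))"
          using a(2) by (intro prod_ge_1) (simp add: Suc_le_eq)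
        then show ?thesis using z by simp
      qed
      finally have "1 \<le> ennreal (z powr (- K) * (z ^ S * (\<Prod>k = 1..n. real (X k \<omega> choose a k))))"
        by simp
      also have "\<dots> = ennreal (z powr (- K)) * F z a \<omega>"
        using F[of z a] z by (simp add: ennreal_mult')
      also have "\<dots> \<le> ennreal (z powr (- K)) * (\<Sum>a\<in>parts n n. F z a \<omega>)"
        using a(1) finite_parts by (intro mult_left_mono member_le_sum) auto
      finally show ?thesis using \<open>\<omega> \<in> E\<close> by (simp add: add_increasing)
    qed
  qed simp
  have int: "(\<integral>\<^sup>+\<omega>. F x a \<omega> \<partial>M) = ennreal (exp ((x - 1) * harm n) * cycle_weight n x a)"
    if "x \<ge> 0" for x a
    unfolding F_def using that by (intro nn_integral_prod_poisson indep distr)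
  have nonneg: "cycle_weight n z a \<ge> 0" for a
    using z by (simp add: cycle_weight_def prod_nonneg)
  have "ennreal (prob E) = (\<integral>\<^sup>+\<omega>. indicator E \<omega> \<partial>M)"
    using E by (simp add: emeasure_eq_measure)
  also have "\<dots> \<le> (\<integral>\<^sup>+\<omega>. ennreal (w powr (- K)) * F w (\<lambda>_. 0) \<omega> +
      ennreal (z powr (- K)) * (\<Sum>a\<in>parts n n. F z a \<omega>) \<partial>M)"
    by (intro nn_integral_mono bound)
  also have "\<dots> = ennreal (w powr (- K)) * (\<integral>\<^sup>+\<omega>. F w (\<lambda>_. 0) \<omega> \<partial>M) +
      ennreal (z powr (- K)) * (\<Sum>a\<in>parts n n. \<integral>\<^sup>+\<omega>. F z a \<omega> \<partial>M)"
    using meas by (simp add: nn_integral_add nn_integral_cmult nn_integral_sum)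
  \<comment> \<open>At the zero vector \<open>cycle_weight n w\<close> is an empty choice and equals
    1.\<close>
  also have "\<dots> = ennreal (w powr (- K) * exp ((w - 1) * harm n) +
      z powr (- K) * (exp ((z - 1) * harm n) * (\<Sum>a\<in>parts n n. cycle_weight n z a)))"
    using w z nonneg
    by (simp add: int cycle_weight_def[of n w] sum_ennreal ennreal_mult'[symmetric]
        ennreal_plus[symmetric] sum_nonneg sum_distrib_left[symmetric] del: ennreal_plus)
  also have "\<dots> \<le> ennreal (w powr (- K) * exp ((w - 1) * harm n) +
      z powr (- K) * (exp ((z - 1) * harm n) * exp ((z - 1) * harm n)))"
    using z by (intro ennreal_leI add_left_mono mult_left_mono sum_cycle_weight_le) auto
  finally have "prob E \<le> w powr (- K) * exp ((w - 1) * harm n) +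
      z powr (- K) * (exp ((z - 1) * harm n) * exp ((z - 1) * harm n))"
    by (subst (asm) ennreal_le_iff) auto
  also have "exp ((z - 1) * harm n) * exp ((z - 1) * harm n) = exp (2 * (z - 1) * harm n)"
    by (simp add: mult_exp_exp algebra_simps)
  finally show ?thesis unfolding E_def .
qed

end

section \<open>Optimising the tilting parameters\<close>

lemma harm_le_ln:
  assumes "n > 0"
  shows "harm n \<le> ln (real n) + 1"
proof -
  obtain m where m: "n = Suc m" using assms gr0_conv_Suc by auto
  have "harm (Suc m) - ln (real (Suc m)) \<le> harm (Suc 0) - ln (real (Suc 0))"
    using decseq_harm_diff_ln by (rule decseqD) simp
  then show ?thesis using m by (simp add: harm_expand)
qed

text \<open>With \<open>K = h / l\<close>, that is \<open>2 powr K = n\<close>, the values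
  \<open>w = 1 / l\<close> and \<open>z = 1 / (2 * l)\<close> minimise the two terms when
  \<open>harm n\<close> is replaced by \<open>h\<close>. Both then have the same exponent
  \<open>eta\<close>.\<close>

lemma (in prob_space) prob_sumset_le_powr_eta:
  fixes X :: "nat \<Rightarrow> 'a \<Rightarrow> nat"
  assumes indep: "indep_vars (\<lambda>_. count_space UNIV) X {1..}"
    and distr: "\<And>k. k \<ge> 1 \<Longrightarrow>
      distr M (count_space UNIV) (X k) = measure_pmf (poisson_pmf (1 / real k))"
    and "n > 0"
  shows "prob {\<omega> \<in> space M. n \<in> sumset (\<lambda>k. X k \<omega>)} \<le> (exp (1 / ln 2) + 1) * real n powr eta"
proof -
  define l where "l = ln (2 :: real)"
  define h :: real where "h = ln (real n)"
  define w where "w = 1 / l"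
  define z where "z = w / 2"
  have l: "1 / 2 \<le> l" "l \<le> 1" "0 < l"
    using ln2_ge_two_thirds ln_2_less_1 by (auto simp: l_def)
  have w: "w \<ge> 1" and z: "0 < z" "z \<le> 1" using l by (auto simp: w_def z_def field_simps)
  \<comment> \<open>Both directions are used: \<open>w - 1\<close> is nonnegative and
    \<open>z - 1\<close> is nonpositive. The extra 1 in the upper bound costs at most the constant
    \<open>exp (1 / l)\<close>.\<close>
  have harm: "h \<le> harm n" "harm n \<le> h + 1"
    using ln_le_harm[of n] harm_le_ln[OF \<open>n > 0\<close>] \<open>n > 0\<close> unfolding h_def
    by (auto intro: order_trans[rotated])
  have eta: "eta = (1 - l + ln l) / l"
    using l by (simp add: eta_def l_def[symmetric] ln_div)
  have pw: "real n powr eta = exp (h * eta)"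
    using \<open>n > 0\<close> by (simp add: powr_def h_def mult.commute)
  have "w powr (- (h / l)) * exp ((w - 1) * harm n) \<le> exp (1 / l) * real n powr eta"
  proof -
    have "(w - 1) * harm n \<le> (w - 1) * (h + 1)" using w harm by (intro mult_left_mono) auto
    then have "- (h / l) * ln w + (w - 1) * harm n \<le> - (h / l) * ln w + (w - 1) * (h + 1)" by simp
    also have "\<dots> \<le> 1 / l + h * eta"
      using l by (simp add: eta w_def ln_div field_simps)
    finally show ?thesis
      using w unfolding pw by (simp add: powr_def mult_exp_exp)
  qed
  moreover have "z powr (- (h / l)) * exp (2 * (z - 1) * harm n) \<le> real n powr eta"
  proof -
    have "2 * (z - 1) * harm n \<le> 2 * (z - 1) * h" using z harm by (intro mult_left_mono_neg) auto
    then have "- (h / l) * ln z + 2 * (z - 1) * harm n \<le> - (h / l) * ln z + 2 * (z - 1) * h" by simp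
    also have "\<dots> = h * eta"
    proof -
      have "ln z = - ln l - l"
        using l by (simp add: z_def w_def ln_div ln_mult_pos l_def[symmetric])
      then show ?thesis using l
        by (simp only: eta) (simp add: z_def w_def divide_simps, simp add: algebra_simps)
    qed
    finally show ?thesis
      using z unfolding pw by (simp add: powr_def mult_exp_exp)
  qed
  ultimately show ?thesis
    using prob_sumset_le[OF indep distr w z, where K = "h / l" and n = n]
    unfolding l_def by (simp add: algebra_simps)
qed

subsection \<open>Counting subset sums\<close>

definition subset_sums :: "nat set \<Rightarrow> nat set" where
  "subset_sums C = (\<lambda>D. \<Sum>D) ` Pow C"

text \<open>Up to the common factor \<open>exp (- harm n)\<close> this is the probability that,
  among the parts up to \<open>n\<close>, exactly those in \<open>C\<close> occur, each
  once.\<close>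

definition weight :: "nat set \<Rightarrow> real" where
  "weight C = (\<Prod>k\<in>C. 1 / real k)"

lemma weight_nonneg: "weight C \<ge> 0"
  by (simp add: weight_def prod_nonneg)

lemma weight_insert: "finite C \<Longrightarrow> k \<notin> C \<Longrightarrow> weight (insert k C) = weight C / real k"
  by (simp add: weight_def)

lemma weight_Un: "finite C \<Longrightarrow> finite D \<Longrightarrow> C \<inter> D = {} \<Longrightarrow> weight (C \<union> D) = weight C * weight D"
  by (simp add: weight_def prod.union_disjoint)

lemma finite_subset_sums: "finite C \<Longrightarrow> finite (subset_sums C)"
  by (simp add: subset_sums_def)

lemma subset_sums_insert:
  assumes "finite C" "k \<notin> C"
  shows "subset_sums (insert k C) = subset_sums C \<union> (+) k ` subset_sums C"
proof -
  have "(\<lambda>D. \<Sum>D) ` insert k ` Pow C = (+) k ` (\<lambda>D. \<Sum>D) ` Pow C"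
    unfolding image_image
  proof (rule image_cong[OF refl])
    fix D assume "D \<in> Pow C"
    with assms have "finite D" "k \<notin> D" by (auto intro: finite_subset)
    then show "\<Sum>(insert k D) = k + \<Sum>D" by simp
  qed
  then show ?thesis
    by (simp add: subset_sums_def Pow_insert image_Un)
qed

lemma card_subset_sums_le: "finite C \<Longrightarrow> card (subset_sums C) \<le> 2 ^ card C"
  unfolding subset_sums_def by (metis card_Pow card_image_le finite_Pow_iff)

text \<open>The pair \<open>(x, x - k)\<close> determines \<open>k\<close>, so on average over \<open>k\<close> few sums collide when a new
  element \<open>k\<close> is adjoined.\<close>

lemma sum_card_translate_Int_le:
  fixes T B :: "nat set"
  assumes "finite T" "finite B"
  shows "(\<Sum>k\<in>B. card (T \<inter> (+) k ` T)) \<le> card T ^ 2"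
proof -
  have "(\<Sum>k\<in>B. card (T \<inter> (+) k ` T)) = card (SIGMA k:B. T \<inter> (+) k ` T)"
    using assms by simp
  also have "\<dots> \<le> card (T \<times> T)"
  proof (rule card_inj_on_le)
    show "inj_on (\<lambda>(k, x). (x, x - k)) (SIGMA k:B. T \<inter> (+) k ` T)"
      by (auto simp: inj_on_def)
    show "(\<lambda>(k, x). (x, x - k)) ` (SIGMA k:B. T \<inter> (+) k ` T) \<subseteq> T \<times> T"
      by auto
  qed (use assms in simp)
  finally show ?thesis by (simp add: card_cartesian_product power2_eq_square)
qed

text \<open>By inclusion-exclusion the union has \<open>2 * card T\<close> elements minus the
  overlap. As each \<open>1 / k\<close> is at most \<open>1 / K\<close>, the weighted overlaps total
  at most \<open>card T ^ 2 / K\<close>, hence at most \<open>card T\<close>.\<close>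

lemma sum_card_Un_translate_ge:
  fixes T B :: "nat set" and K :: nat
  assumes T: "finite T" "card T \<le> K" and B: "finite B" "\<And>k. k \<in> B \<Longrightarrow> K \<le> k" and "K > 0"
  shows "(2 * (\<Sum>k\<in>B. 1 / real k) - 1) * card T \<le> (\<Sum>k\<in>B. card (T \<union> (+) k ` T) / real k)"
proof -
  have eq: "real (card (T \<union> (+) k ` T)) = 2 * card T - real (card (T \<inter> (+) k ` T))" for k
  proof -
    have "card (T \<union> (+) k ` T) + card (T \<inter> (+) k ` T) = card T + card ((+) k ` T)"
      using T by (metis card_Un_Int finite_imageI)
    moreover have "card ((+) k ` T) = card T" by (simp add: card_image)
    ultimately show ?thesis by linarith
  qed
  have "(\<Sum>k\<in>B. card (T \<inter> (+) k ` T) / real k) \<le> (\<Sum>k\<in>B. card (T \<inter> (+) k ` T) / real K)"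
    using B \<open>K > 0\<close> by (intro sum_mono divide_left_mono) (auto dest!: B(2))
  also have "\<dots> = real (\<Sum>k\<in>B. card (T \<inter> (+) k ` T)) / K"
    by (simp add: sum_divide_distrib)
  also have "\<dots> \<le> real (card T ^ 2) / K"
    using sum_card_translate_Int_le[OF T(1) B(1)] by (intro divide_right_mono of_nat_mono) auto
  also have "\<dots> \<le> card T"
    using T(2) \<open>K > 0\<close> by (simp add: power2_eq_square divide_le_eq mult_left_mono)
  finally have "(\<Sum>k\<in>B. card (T \<inter> (+) k ` T) / real k) \<le> card T" .
  moreover have "(\<Sum>k\<in>B. card (T \<union> (+) k ` T) / real k) =
      2 * card T * (\<Sum>k\<in>B. 1 / real k) - (\<Sum>k\<in>B. card (T \<inter> (+) k ` T) / real k)"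
    unfolding eq by (simp add: diff_divide_distrib sum_subtractf sum_distrib_left)
  ultimately show ?thesis by (simp add: algebra_simps)
qed

text \<open>Double counting: a set of size \<open>i + 1\<close> arises once for each choice of its
  last adjoined element.\<close>

lemma sum_card_Suc_subsets:
  fixes f :: "'a set \<Rightarrow> real"
  assumes "finite B"
  shows "(\<Sum>D | D \<subseteq> B \<and> card D = i. \<Sum>k\<in>B - D. f (insert k D)) =
    real (Suc i) * (\<Sum>D | D \<subseteq> B \<and> card D = Suc i. f D)"
proof -
  have fin: "finite {D. D \<subseteq> B \<and> card D = j}" for j
    using assms by simp
  have finD: "finite D" if "D \<subseteq> B" for D using assms that by (rule rev_finite_subset)
  have "(\<Sum>D | D \<subseteq> B \<and> card D = i. \<Sum>k\<in>B - D. f (insert k D)) =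
    (\<Sum>(D, k)\<in>(SIGMA D:{D. D \<subseteq> B \<and> card D = i}. B - D). f (insert k D))"
    using assms fin by (subst sum.Sigma) auto
  also have "\<dots> = (\<Sum>(D, k)\<in>(SIGMA D:{D. D \<subseteq> B \<and> card D = Suc i}. D). f D)"
    by (rule sum.reindex_bij_witness[where i = "\<lambda>(D, k). (D - {k}, k)"
          and j = "\<lambda>(D, k). (insert k D, k)"])
       (auto simp: insert_absorb finD)
  also have "\<dots> = (\<Sum>D | D \<subseteq> B \<and> card D = Suc i. \<Sum>k\<in>D. f D)"
    using fin finD by (subst sum.Sigma) auto
  also have "\<dots> = (\<Sum>D | D \<subseteq> B \<and> card D = Suc i. real (Suc i) * f D)"
    by (rule sum.cong) auto
  finally show ?thesis by (simp add: sum_distrib_left)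
qed

lemma two_times_le_power2: "2 * i \<le> 2 ^ (i :: nat)"
proof (cases i)
  case (Suc j)
  have "j < 2 ^ j" by simp
  then have "Suc j \<le> 2 ^ j" by (simp only: Suc_le_eq)
  with Suc show ?thesis by simp
qed simp

text \<open>Elements of \<open>B\<close> are adjoined one at a time. Each step gains
  \<open>2 * L\<close>, loses 1 to collisions and 1 to elements already chosen; the factorial
  removes the order of choice. The bound on \<open>K\<close> keeps the number of sums below every
  element of \<open>B\<close> throughout.\<close>

lemma sum_weight_card_subset_sums_ge:
  fixes B C :: "nat set" and K t :: nat
  defines "L \<equiv> (\<Sum>k\<in>B. 1 / real k)"
  assumes "finite B" "finite C" "B \<inter> C = {}" and K: "2 ^ (card C + t) \<le> K" "\<And>k. k \<in> B \<Longrightarrow> K \<le> k"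
    and "L \<ge> 1" and "i \<le> t"
  shows "(2 * (L - 1)) ^ i / fact i * card (subset_sums C) \<le>
    (\<Sum>D | D \<subseteq> B \<and> card D = i. weight D * card (subset_sums (C \<union> D)))"
  using \<open>i \<le> t\<close>
proof (induction i)
  case 0
  have "{D. D \<subseteq> B \<and> card D = 0} = {{}}"
    using \<open>finite B\<close> by (auto dest: finite_subset)
  then show ?case by (simp add: weight_def)
next
  case (Suc i)
  define f where "f D = weight D * card (subset_sums (C \<union> D))" for D
  have "K > 0" using K(1) by (meson less_le_trans pos2 zero_less_power)
  have step: "2 * (L - 1) * f D \<le> (\<Sum>k\<in>B - D. f (insert k D))" if D: "D \<subseteq> B" "card D = i" for D
  proof -
    let ?T = "subset_sums (C \<union> D)"
    have "finite D" using D \<open>finite B\<close> by (meson finite_subset)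
    have fin: "finite ?T" using \<open>finite C\<close> \<open>finite D\<close> by (simp add: finite_subset_sums)
    have "card ?T \<le> 2 ^ card (C \<union> D)"
      using \<open>finite C\<close> \<open>finite D\<close> by (simp add: card_subset_sums_le)
    also have "\<dots> \<le> 2 ^ (card C + t)"
      using card_Un_le[of C D] D Suc.prems by (intro power_increasing) auto
    finally have "card ?T \<le> K" using K(1) by simp
    have ge: "(2 * L - 1) * card ?T \<le> (\<Sum>k\<in>B. card (?T \<union> (+) k ` ?T) / real k)"
      unfolding L_def
      by (rule sum_card_Un_translate_ge[where K = K])
         (use fin \<open>card ?T \<le> K\<close> \<open>finite B\<close> K(2) \<open>K > 0\<close> in auto)
    \<comment> \<open>The \<open>i\<close> elements already in \<open>D\<close> cannot be adjoined
      again. They account for at most \<open>2 * i / K\<close> times \<open>card ?T\<close>, and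
      \<open>2 * i \<le> 2 ^ i \<le> K\<close>.\<close>
    have "(\<Sum>k\<in>D. card (?T \<union> (+) k ` ?T) / real k) \<le> (\<Sum>k\<in>D. 2 * card ?T / real K)"
    proof (intro sum_mono frac_le)
      fix k assume "k \<in> D"
      show "real (card (?T \<union> (+) k ` ?T)) \<le> 2 * card ?T"
        using card_Un_le[of ?T "(+) k ` ?T"] card_image_le[OF fin, of "(+) k"] by linarith
      show "real K \<le> real k" using K(2) \<open>k \<in> D\<close> D by auto
    qed (use \<open>K > 0\<close> in auto)
    also have "\<dots> = real (2 * i) / K * card ?T" using D by simp
    also have "\<dots> \<le> 1 * real (card ?T)"
    proof (intro mult_right_mono)
      have "2 * i \<le> 2 ^ i" by (rule two_times_le_power2)
      also have "\<dots> \<le> 2 ^ (card C + t)" using Suc.prems by (intro power_increasing) auto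
      finally have "2 * i \<le> K" using K(1) by linarith
      then show "real (2 * i) / real K \<le> 1" using \<open>K > 0\<close> by (simp add: divide_le_eq_1)
    qed auto
    finally have le: "(\<Sum>k\<in>D. card (?T \<union> (+) k ` ?T) / real k) \<le> card ?T" by simp
    have "2 * (L - 1) * card ?T \<le> (\<Sum>k\<in>B. card (?T \<union> (+) k ` ?T) / real k) -
        (\<Sum>k\<in>D. card (?T \<union> (+) k ` ?T) / real k)"
      using ge le by (simp add: algebra_simps)
    also have "\<dots> = (\<Sum>k\<in>B - D. card (?T \<union> (+) k ` ?T) / real k)"
      using D \<open>finite B\<close> by (simp add: sum_diff)
    finally have "weight D * (2 * (L - 1) * card ?T) \<le>
        weight D * (\<Sum>k\<in>B - D. card (?T \<union> (+) k ` ?T) / real k)"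
      by (intro mult_left_mono weight_nonneg)
    also have "\<dots> = (\<Sum>k\<in>B - D. f (insert k D))"
      unfolding sum_distrib_left
    proof (rule sum.cong[OF refl])
      fix k assume k: "k \<in> B - D"
      then have "k \<notin> C \<union> D" using \<open>B \<inter> C = {}\<close> by auto
      then have "subset_sums (C \<union> insert k D) = ?T \<union> (+) k ` ?T"
        using subset_sums_insert[of "C \<union> D" k] \<open>finite C\<close> \<open>finite D\<close> by simp
      then show "weight D * (card (?T \<union> (+) k ` ?T) / real k) = f (insert k D)"
        using k \<open>finite D\<close> by (simp add: f_def weight_insert)
    qed
    finally show ?thesis by (simp add: f_def mult_ac)
  qed
  have "(2 * (L - 1)) ^ Suc i / fact (Suc i) * card (subset_sums C) =
      2 * (L - 1) / real (Suc i) * ((2 * (L - 1)) ^ i / fact i * card (subset_sums C))"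
    by (simp add: field_simps del: of_nat_Suc)
  also have "\<dots> \<le> 2 * (L - 1) / real (Suc i) * (\<Sum>D | D \<subseteq> B \<and> card D = i. f D)"
    using Suc \<open>L \<ge> 1\<close> by (intro mult_left_mono) (simp_all add: f_def)
  also have "\<dots> = (\<Sum>D | D \<subseteq> B \<and> card D = i. 2 * (L - 1) * f D) / real (Suc i)"
    by (simp add: sum_distrib_left sum_divide_distrib)
  also have "\<dots> \<le> (\<Sum>D | D \<subseteq> B \<and> card D = i. \<Sum>k\<in>B - D. f (insert k D)) / real (Suc i)"
    using step by (intro divide_right_mono sum_mono) auto
  also have "\<dots> = (\<Sum>D | D \<subseteq> B \<and> card D = Suc i. f D)"
    unfolding sum_card_Suc_subsets[OF \<open>finite B\<close>] by simp
  finally show ?case unfolding f_def .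
qed

section \<open>Dyadic block construction\<close>

text \<open>Unions of \<open>t\<close>-subsets of the blocks \<open>[2^(ti), 2^(t(i+1)))\<close>, \<open>1 \<le> i \<le> j\<close>. The block below \<open>2^t\<close>
  stays empty, so that the number of subset sums never exceeds the size of the next element.\<close>

fun block_family :: "nat \<Rightarrow> nat \<Rightarrow> nat set set" where
  "block_family t 0 = {{}}"
| "block_family t (Suc j) = (\<lambda>(C, D). C \<union> D) `
     (block_family t j \<times> {D. D \<subseteq> {2 ^ (t * (j + 1))..<2 ^ (t * (j + 2))} \<and> card D = t})"

lemma finite_block_family: "finite (block_family t j)"
  by (induction j) auto

lemma block_familyD:
  assumes "C \<in> block_family t j"
  shows "C \<subseteq> {1..<2 ^ (t * (j + 1))}" and "card C = t * j"
proof -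
  have "C \<subseteq> {1..<2 ^ (t * (j + 1))} \<and> card C = t * j"
    using assms
  proof (induction j arbitrary: C)
    case (Suc j)
    then obtain A D where AD: "C = A \<union> D" "A \<in> block_family t j"
      "D \<subseteq> {2 ^ (t * (j + 1))..<2 ^ (t * (j + 2))}" "card D = t"
      by auto
    have A: "A \<subseteq> {1..<2 ^ (t * (j + 1))}" "card A = t * j"
      using Suc.IH[OF AD(2)] by auto
    have "finite A" "finite D" using A AD by (auto intro: finite_subset)
    moreover have "A \<inter> D = {}" using A(1) AD(3) by force
    ultimately have "card C = t * Suc j"
      using A(2) AD(1,4) by (simp add: card_Un_disjoint)
    moreover have "(1::nat) \<le> 2 ^ (t * (j + 1))" "(2::nat) ^ (t * (j + 1)) \<le> 2 ^ (t * (j + 2))"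
      by (rule one_le_power power_increasing; simp)+
    then have "{1..<2 ^ (t * (j + 1))} \<union> {2 ^ (t * (j + 1))..<2 ^ (t * (j + 2))} =
        {1..<(2::nat) ^ (t * (j + 2))}"
      by (rule ivl_disj_un_two(3))
    then have "C \<subseteq> {1..<2 ^ (t * (j + 2))}"
      unfolding AD(1) using A(1) AD(3) by blast
    ultimately show ?case by simp
  qed auto
  then show "C \<subseteq> {1..<2 ^ (t * (j + 1))}" and "card C = t * j" by auto
qed

text \<open>The bounds \<open>t * 2 ^ (t * (j + 1))\<close> for the sums of successive blocks at
  least double, so the top block's bound dominates up to a factor 2.\<close>

lemma sum_block_family_le:
  assumes "C \<in> block_family t j" "t > 0"
  shows "\<Sum>C \<le> 2 * t * 2 ^ (t * (j + 1))"
  using assms(1)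
proof (induction j arbitrary: C)
  case (Suc j)
  then obtain A D where AD: "C = A \<union> D" "A \<in> block_family t j"
    "D \<subseteq> {2 ^ (t * (j + 1))..<2 ^ (t * (j + 2))}" "card D = t"
    by auto
  have "finite A" "finite D" using block_familyD[OF AD(2)] AD by (auto intro: finite_subset)
  then have "\<Sum>C \<le> \<Sum>A + \<Sum>D" unfolding AD
    using sum.union_inter[of A D "\<lambda>x. x"] by linarith
  also have "\<Sum>D \<le> t * 2 ^ (t * (j + 2))"
  proof -
    have "x \<le> 2 ^ (t * (j + 2))" if "x \<in> D" for x
      using that AD(3) by (meson atLeastLessThan_iff less_imp_le subsetD)
    then show ?thesis using sum_bounded_above[of D "\<lambda>x. x" "2 ^ (t * (j + 2))"] AD(4) by simp
  qed
  also have "\<Sum>A \<le> 2 * t * 2 ^ (t * (j + 1))" using Suc.IH[OF AD(2)] .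
  also have "2 * 2 ^ (t * (j + 1)) \<le> (2 :: nat) ^ (t * (j + 2))"
  proof -
    have "2 * 2 ^ (t * (j + 1)) = (2 :: nat) ^ (t * (j + 1) + 1)" by simp
    also have "\<dots> \<le> 2 ^ (t * (j + 2))" using \<open>t > 0\<close> by (intro power_increasing) auto
    finally show ?thesis .
  qed
  then have "2 * t * 2 ^ (t * (j + 1)) \<le> t * (2 :: nat) ^ (t * (j + 2))"
    by (metis (no_types) mult.assoc mult.commute mult_le_mono2)
  finally show ?case by simp
qed simp

text \<open>Telescoping with \<open>ln (1 + 1 / b) \<le> 1 / b\<close>.\<close>

lemma ln_le_sum_inverse_block:
  assumes "0 < a" "a \<le> b"
  shows "ln (real b / real a) \<le> (\<Sum>k = a..<b. 1 / real k)"
  using assms(2)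
proof (induction b rule: dec_induct)
  case (step b)
  have "ln (real (Suc b) / a) = ln (real b / a) + ln (1 + 1 / real b)"
  proof -
    have "b > 0" using step assms by linarith
    then have "real (Suc b) / a = (real b / a) * (1 + 1 / real b)"
      using assms(1) by (simp add: divide_simps)
    moreover have "ln ((real b / a) * (1 + 1 / real b)) = ln (real b / a) + ln (1 + 1 / real b)"
      using \<open>b > 0\<close> assms(1) by (intro ln_mult_pos) (auto intro: add_pos_pos)
    ultimately show ?thesis by (simp only:)
  qed
  also have "ln (1 + 1 / real b) \<le> 1 / real b" by (rule ln_add_one_self_le_self) simp
  finally show ?case using step by simp
qed (use assms in auto)

text \<open>Blocks are disjoint, so weights multiply and the one-block estimate can be iterated. The
  ratio of the endpoints of a block is \<open>2 ^ t\<close>, whence its reciprocals sum to at least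
  \<open>t * ln 2\<close>.\<close>

lemma sum_block_family_ge:
  fixes t j :: nat
  assumes "t * ln 2 \<ge> 1"
  shows "((2 * (t * ln 2 - 1)) ^ t / fact t) ^ j \<le>
    (\<Sum>C\<in>block_family t j. weight C * card (subset_sums C))"
proof (induction j)
  case 0
  show ?case by (simp add: weight_def subset_sums_def)
next
  case (Suc j)
  define B where "B = {(2 :: nat) ^ (t * (j + 1))..<2 ^ (t * (j + 2))}"
  define P where "P = {D. D \<subseteq> B \<and> card D = t}"
  define G :: real where "G = (2 * (t * ln 2 - 1)) ^ t / fact t"
  have "finite B" by (simp add: B_def)
  have "G \<ge> 0" using assms by (simp add: G_def)
  have disj: "C \<inter> B = {}" if "C \<in> block_family t j" for C
    using block_familyD(1)[OF that] by (force simp: B_def)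
  have fin: "finite C" if "C \<in> block_family t j" for C
    using block_familyD(1)[OF that] by (rule finite_subset) simp
  \<comment> \<open>Intersecting the union with the new block \<open>B\<close> recovers
    \<open>D\<close>, and removing \<open>B\<close> recovers \<open>C\<close>.\<close>
  have inj: "inj_on (\<lambda>(C, D). C \<union> D) (block_family t j \<times> P)"
  proof (rule inj_onI, clarify)
    fix C D C' D' assume *: "C \<in> block_family t j" "C' \<in> block_family t j" "D \<in> P" "D' \<in> P"
      "C \<union> D = C' \<union> D'"
    have "C = (C \<union> D) - B" "C' = (C' \<union> D') - B" "D = (C \<union> D) \<inter> B" "D' = (C' \<union> D') \<inter> B"
      using disj[OF *(1)] disj[OF *(2)] *(3,4) by (auto simp: P_def)
    then show "C = C' \<and> D = D'" using *(5) by metis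
  qed
  define L where "L = (\<Sum>k\<in>B. 1 / real k)"
  have L: "t * ln 2 \<le> L"
  proof -
    have "ln (real (2 ^ (t * (j + 2))) / real (2 ^ (t * (j + 1)))) \<le> L"
      unfolding L_def B_def by (rule ln_le_sum_inverse_block) (auto intro: power_increasing)
    then show ?thesis by (simp add: ln_div ln_realpow algebra_simps)
  qed
  have step: "G * card (subset_sums C) \<le> (\<Sum>D\<in>P. weight D * card (subset_sums (C \<union> D)))"
    if C: "C \<in> block_family t j" for C
  proof -
    have "G * card (subset_sums C) \<le> (2 * (L - 1)) ^ t / fact t * card (subset_sums C)"
      unfolding G_def using L assms by (intro mult_right_mono divide_right_mono power_mono) auto
    also have "\<dots> \<le> (\<Sum>D\<in>P. weight D * card (subset_sums (C \<union> D)))"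
      unfolding P_def L_def
    proof (rule sum_weight_card_subset_sums_ge)
      \<comment> \<open>This is an equality, since \<open>card C = t * j\<close>. A further
        \<open>t\<close> elements below \<open>2 ^ t\<close> would break it.\<close>
      show "2 ^ (card C + t) \<le> (2 :: nat) ^ (t * (j + 1))"
        using block_familyD(2)[OF C] by simp
      show "B \<inter> C = {}" using disj[OF C] by auto
      show "1 \<le> (\<Sum>k\<in>B. 1 / real k)" using L assms unfolding L_def by linarith
    qed (use fin[OF C] \<open>finite B\<close> in \<open>auto simp: B_def\<close>)
    finally show ?thesis .
  qed
  have "G ^ Suc j = G * G ^ j" by simp
  also have "\<dots> \<le> G * (\<Sum>C\<in>block_family t j. weight C * card (subset_sums C))"
    using Suc \<open>G \<ge> 0\<close> unfolding G_def by (intro mult_left_mono) auto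
  also have "\<dots> = (\<Sum>C\<in>block_family t j. weight C * (G * card (subset_sums C)))"
    by (simp add: sum_distrib_left mult_ac)
  also have "\<dots> \<le> (\<Sum>C\<in>block_family t j. weight C * (\<Sum>D\<in>P. weight D * card (subset_sums (C \<union> D))))"
    by (intro sum_mono mult_left_mono step weight_nonneg)
  also have "\<dots> = (\<Sum>C\<in>block_family t j. \<Sum>D\<in>P. weight (C \<union> D) * card (subset_sums (C \<union> D)))"
    unfolding sum_distrib_left
  proof (intro sum.cong refl)
    fix C D assume "C \<in> block_family t j" "D \<in> P"
    then have "weight (C \<union> D) = weight C * weight D"
      using disj fin \<open>finite B\<close> by (intro weight_Un) (auto simp: P_def intro: finite_subset)
    then show "weight C * (weight D * card (subset_sums (C \<union> D))) =
        weight (C \<union> D) * card (subset_sums (C \<union> D))" by simp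
  qed
  also have "\<dots> = (\<Sum>C\<in>block_family t (Suc j). weight C * card (subset_sums C))"
    unfolding block_family.simps using inj
    by (subst sum.reindex) (auto simp: sum.cartesian_product P_def B_def case_prod_unfold)
  finally show ?case unfolding G_def .
qed

subsection \<open>Lower bound\<close>

lemma subset_sums_le: "x \<in> subset_sums C \<Longrightarrow> finite C \<Longrightarrow> x \<le> \<Sum>C"
  unfolding subset_sums_def by (auto intro!: sum_mono2)

section \<open>From weighted families of part sets to probabilities\<close>

context prob_space
begin

text \<open>The events that the multiplicities up to \<open>n\<close> form the indicator of
  \<open>A\<close> are disjoint for distinct \<open>A\<close>. Each has probability
  \<open>exp (- harm n) * weight A\<close> and forces \<open>n\<close> to be a sum.\<close>

lemma prob_sumset_ge_sum_weight:
  fixes X :: "nat \<Rightarrow> 'a \<Rightarrow> nat" and \<A> :: "nat set set"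
  assumes indep: "indep_vars (\<lambda>_. count_space UNIV) X {1..}"
    and distr: "\<And>k. k \<ge> 1 \<Longrightarrow>
      distr M (count_space UNIV) (X k) = measure_pmf (poisson_pmf (1 / real k))"
    and \<A>: "\<And>A. A \<in> \<A> \<Longrightarrow> A \<subseteq> {1..n}" "\<And>A. A \<in> \<A> \<Longrightarrow> n \<in> subset_sums A"
    and "n > 0"
  shows "exp (- harm n) * (\<Sum>A\<in>\<A>. weight A) \<le> prob {\<omega> \<in> space M. n \<in> sumset (\<lambda>k. X k \<omega>)}"
proof -
  have X: "random_variable (count_space UNIV) (X k)" if "k \<ge> 1" for k
    using indep that by (auto simp: indep_vars_def)
  define E where "E A = (\<Inter>k\<in>{1..n}. X k -` {of_bool (k \<in> A)} \<inter> space M)" for A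
  have fin: "finite \<A>" using \<A>(1) by (intro finite_subset[of \<A> "Pow {1..n}"]) auto
  have E: "E A \<in> events" for A
    unfolding E_def using X \<open>n > 0\<close> by (intro sets.finite_INT) (auto intro!: measurable_sets)
  have "prob (E A) = exp (- harm n) * weight A" if "A \<in> \<A>" for A
  proof -
    have "prob (E A) = (\<Prod>k\<in>{1..n}. prob (X k -` {of_bool (k \<in> A)} \<inter> space M))"
      unfolding E_def using \<open>n > 0\<close> by (intro indep_varsD[OF indep]) auto
    also have "\<dots> = (\<Prod>k\<in>{1..n}. exp (- (1 / real k)) * (if k \<in> A then 1 / real k else 1))"
    proof (rule prod.cong[OF refl])
      fix k assume k: "k \<in> {1..n}"
      have "prob (X k -` {of_bool (k \<in> A)} \<inter> space M) =
          measure (distr M (count_space UNIV) (X k)) {of_bool (k \<in> A)}"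
        using X k by (subst measure_distr) auto
      also have "\<dots> = pmf (poisson_pmf (1 / real k)) (of_bool (k \<in> A))"
        using distr k by (simp add: pmf.rep_eq)
      finally show "prob (X k -` {of_bool (k \<in> A)} \<inter> space M) =
          exp (- (1 / real k)) * (if k \<in> A then 1 / real k else 1)"
        using k by simp
    qed
    also have "\<dots> = exp (- harm n) * (\<Prod>k\<in>{1..n}. if k \<in> A then 1 / real k else 1)"
      by (simp add: prod.distrib exp_sum[symmetric] harm_def sum_negf divide_inverse)
    also have "(\<Prod>k\<in>{1..n}. if k \<in> A then 1 / real k else 1) = weight A"
      unfolding weight_def using \<A>(1)[OF that] by (intro prod.mono_neutral_cong_right) auto
    finally show ?thesis .
  qed
  then have "exp (- harm n) * (\<Sum>A\<in>\<A>. weight A) = (\<Sum>A\<in>\<A>. prob (E A))"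
    by (simp add: sum_distrib_left)
  also have "\<dots> = prob (\<Union>A\<in>\<A>. E A)"
  proof (rule finite_measure_finite_Union[symmetric, OF fin])
    show "disjoint_family_on E \<A>"
      unfolding disjoint_family_on_def
    proof (intro ballI impI)
      fix A B assume *: "A \<in> \<A>" "B \<in> \<A>" "A \<noteq> B"
      then obtain k where k: "k \<in> {1..n}" "(k \<in> A) \<noteq> (k \<in> B)"
        using \<A>(1) by blast
      then have "of_bool (k \<in> A) \<noteq> (of_bool (k \<in> B) :: nat)" by simp
      then show "E A \<inter> E B = {}" using k(1) unfolding E_def by fastforce
    qed
  qed (use E in auto)
  also have "\<dots> \<le> prob {\<omega> \<in> space M. n \<in> sumset (\<lambda>k. X k \<omega>)}"
  proof (intro finite_measure_mono sumset_event_measurable X)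
    show "(\<Union>A\<in>\<A>. E A) \<subseteq> {\<omega> \<in> space M. n \<in> sumset (\<lambda>k. X k \<omega>)}"
    proof clarify
      fix A \<omega> assume A: "A \<in> \<A>" and \<omega>: "\<omega> \<in> E A"
      obtain D where D: "D \<subseteq> A" "n = \<Sum>D" using \<A>(2)[OF A] by (auto simp: subset_sums_def)
      have sub: "D \<subseteq> {1..n}" using D \<A>(1)[OF A] by simp
      have "(\<Sum>k = 1..n. of_bool (k \<in> D) * k) = (\<Sum>k\<in>D. k)"
        using sub by (intro sum.mono_neutral_cong_right) auto
      then have "(\<lambda>k. of_bool (k \<in> D)) \<in> parts n n"
        using sub D(2) by (auto simp: parts_def)
      moreover have "of_bool (k \<in> D) \<le> X k \<omega>" if "k \<in> {1..n}" for k
        using \<omega> that D(1) unfolding E_def by fastforce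
      moreover have "\<omega> \<in> space M" using \<omega> \<open>n > 0\<close> unfolding E_def by fastforce
      ultimately show "\<omega> \<in> space M \<and> n \<in> sumset (\<lambda>k. X k \<omega>)"
        by (auto simp: mem_sumset_iff intro!: bexI[of _ "\<lambda>k. of_bool (k \<in> D)"])
    qed
  qed auto
  finally show ?thesis .
qed

text \<open>Each subset sum \<open>s\<close> of \<open>C\<close> is completed to \<open>n\<close> by
  the extra part \<open>n - s\<close>, whose weight is at least \<open>1 / n\<close>. The room
  \<open>m\<close> left in \<open>n\<close> puts this part above all of \<open>C\<close>.\<close>

lemma prob_sumset_ge_subset_sums:
  fixes X :: "nat \<Rightarrow> 'a \<Rightarrow> nat" and \<C> :: "nat set set"
  assumes indep: "indep_vars (\<lambda>_. count_space UNIV) X {1..}"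
    and distr: "\<And>k. k \<ge> 1 \<Longrightarrow>
      distr M (count_space UNIV) (X k) = measure_pmf (poisson_pmf (1 / real k))"
    and fin: "finite \<C>"
    and \<C>: "\<And>C. C \<in> \<C> \<Longrightarrow> C \<subseteq> {1..<m}" "\<And>C. C \<in> \<C> \<Longrightarrow> \<Sum>C + m \<le> n"
    and "n > 0" "m > 0"
  shows "exp (- harm n) / real n * (\<Sum>C\<in>\<C>. weight C * card (subset_sums C)) \<le>
    prob {\<omega> \<in> space M. n \<in> sumset (\<lambda>k. X k \<omega>)}"
proof -
  define P where "P = (SIGMA C:\<C>. subset_sums C)"
  define \<phi> where "\<phi> = (\<lambda>(C, s). insert (n - s) C)"
  have finC: "finite C" if "C \<in> \<C>" for C using \<C>(1)[OF that] by (rule finite_subset) simp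
  have ge: "m \<le> n - s" "s \<le> n" if "C \<in> \<C>" "s \<in> subset_sums C" for C s
    using subset_sums_le[OF that(2) finC] \<C>(2) that(1) by fastforce+
  have inj: "inj_on \<phi> P"
  proof (rule inj_onI)
    fix p q assume "p \<in> P" "q \<in> P" and eq: "\<phi> p = \<phi> q"
    then obtain C s C' s' where pq: "p = (C, s)" "q = (C', s')" "C \<in> \<C>" "s \<in> subset_sums C"
      "C' \<in> \<C>" "s' \<in> subset_sums C'" by (auto simp: P_def)
    have eq: "insert (n - s) C = insert (n - s') C'" using eq pq by (simp add: \<phi>_def)
    \<comment> \<open>Cutting at \<open>m\<close> separates \<open>C\<close> from the completing
      part, and the latter determines \<open>s\<close> because \<open>s \<le> n\<close>.\<close>
    have "insert (n - s) C \<inter> {..<m} = C" "insert (n - s') C' \<inter> {..<m} = C'"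
      "insert (n - s) C - {..<m} = {n - s}" "insert (n - s') C' - {..<m} = {n - s'}"
      using ge(1)[OF pq(3,4)] ge(1)[OF pq(5,6)] \<C>(1)[OF pq(3)] \<C>(1)[OF pq(5)] by auto
    then have "C = C'" "{n - s} = {n - s'}" using eq by metis+
    then show "p = q" using ge(2)[OF pq(3,4)] ge(2)[OF pq(5,6)] pq(1,2) by auto
  qed
  have "(\<Sum>C\<in>\<C>. weight C * card (subset_sums C)) / real n =
      (\<Sum>C\<in>\<C>. \<Sum>s\<in>subset_sums C. weight C / real n)"
    by (simp add: sum_divide_distrib mult.commute)
  also have "\<dots> = (\<Sum>(C, s)\<in>P. weight C / real n)"
    unfolding P_def using fin finC by (subst sum.Sigma) (auto simp: finite_subset_sums)
  also have "\<dots> \<le> (\<Sum>p\<in>P. weight (\<phi> p))"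
  proof (rule sum_mono)
    fix p assume "p \<in> P"
    then obtain C s where p: "p = (C, s)" "C \<in> \<C>" "s \<in> subset_sums C" by (auto simp: P_def)
    have "n - s \<notin> C" using ge(1)[OF p(2,3)] \<C>(1)[OF p(2)] by force
    then have "weight (\<phi> p) = weight C / real (n - s)"
      using finC[OF p(2)] p(1) by (simp add: \<phi>_def weight_insert)
    also have "\<dots> \<ge> weight C / real n"
      using ge(1)[OF p(2,3)] \<open>m > 0\<close> by (intro divide_left_mono weight_nonneg) auto
    finally show "(case p of (C, s) \<Rightarrow> weight C / real n) \<le> weight (\<phi> p)" using p(1) by simp
  qed
  also have "\<dots> = (\<Sum>A\<in>\<phi> ` P. weight A)" using inj by (simp add: sum.reindex)
  finally have "exp (- harm n) * ((\<Sum>C\<in>\<C>. weight C * card (subset_sums C)) / real n) \<le>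
      exp (- harm n) * (\<Sum>A\<in>\<phi> ` P. weight A)" by (intro mult_left_mono) auto
  also have "\<dots> \<le> prob {\<omega> \<in> space M. n \<in> sumset (\<lambda>k. X k \<omega>)}"
  proof (rule prob_sumset_ge_sum_weight[OF indep distr])
    fix A assume "A \<in> \<phi> ` P"
    then obtain C s where A: "A = insert (n - s) C" "C \<in> \<C>" "s \<in> subset_sums C"
      by (auto simp: P_def \<phi>_def)
    have "m \<le> n" using \<C>(2)[OF A(2)] by simp
    then show "A \<subseteq> {1..n}" using A \<C>(1)[OF A(2)] ge(1)[OF A(2,3)] \<open>m > 0\<close> by force
    have "n - s \<notin> C" using ge(1)[OF A(2,3)] \<C>(1)[OF A(2)] by force
    then have "subset_sums A = subset_sums C \<union> (+) (n - s) ` subset_sums C"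
      using subset_sums_insert finC A by simp
    then show "n \<in> subset_sums A" using A(3) ge(2)[OF A(2,3)] by force
  qed (use \<open>n > 0\<close> in auto)
  finally show ?thesis by simp
qed

text \<open>One factor \<open>1 / n\<close> comes from \<open>exp (- harm n)\<close>, the other from
  the completing part.\<close>

lemma prob_sumset_ge_block:
  fixes X :: "nat \<Rightarrow> 'a \<Rightarrow> nat"
  assumes indep: "indep_vars (\<lambda>_. count_space UNIV) X {1..}"
    and distr: "\<And>k. k \<ge> 1 \<Longrightarrow>
      distr M (count_space UNIV) (X k) = measure_pmf (poisson_pmf (1 / real k))"
    and t: "t * ln 2 \<ge> 1" and n: "4 * t * 2 ^ (t * (j + 1)) \<le> n"
  shows "exp (- 1) / real n ^ 2 * ((2 * (t * ln 2 - 1)) ^ t / fact t) ^ j \<le>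
    prob {\<omega> \<in> space M. n \<in> sumset (\<lambda>k. X k \<omega>)}"
proof -
  have "t > 0" using t by (cases t) auto
  then have "n > 0" using n by (metis gr0I le_zero_eq mult_is_0 power_not_zero
        zero_neq_numeral)
  have "exp (- 1) / real n ^ 2 = exp (- (ln (real n) + 1)) / real n"
    using \<open>n > 0\<close> by (simp add: exp_add exp_minus exp_diff power2_eq_square field_simps)
  also have "\<dots> \<le> exp (- harm n) / real n"
    using harm_le_ln[OF \<open>n > 0\<close>] by (intro divide_right_mono) auto
  finally have "exp (- 1) / real n ^ 2 * ((2 * (t * ln 2 - 1)) ^ t / fact t) ^ j \<le>
      exp (- harm n) / real n * (\<Sum>C\<in>block_family t j. weight C * card (subset_sums C))"
    using sum_block_family_ge[OF t, of j] t by (intro mult_mono) auto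
  also have "\<dots> \<le> prob {\<omega> \<in> space M. n \<in> sumset (\<lambda>k. X k \<omega>)}"
  proof (rule prob_sumset_ge_subset_sums[OF indep distr finite_block_family])
    fix C assume C: "C \<in> block_family t j"
    show "C \<subseteq> {1..<2 ^ (t * (j + 1))}" using block_familyD(1)[OF C] .
    \<comment> \<open>The sum of \<open>C\<close> takes \<open>2 * t\<close> units of
      \<open>2 ^ (t * (j + 1))\<close> and the room for the completing part at most \<open>t\<close>
      more, within the \<open>4 * t\<close> available.\<close>
    have "\<Sum>C + 2 ^ (t * (j + 1)) \<le> 2 * t * 2 ^ (t * (j + 1)) + t * 2 ^ (t * (j + 1))"
      using sum_block_family_le[OF C \<open>t > 0\<close>] \<open>t > 0\<close> by (intro add_mono) auto
    also have "\<dots> \<le> 4 * t * 2 ^ (t * (j + 1))" by simp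
    finally show "\<Sum>C + 2 ^ (t * (j + 1)) \<le> n" using n by linarith
  qed (use \<open>n > 0\<close> in auto)
  finally show ?thesis .
qed

end

section \<open>Choice of the block length\<close>

lemma ln_fact_le:
  assumes "t > 0"
  shows "ln (fact t :: real) \<le> real t * ln (real t) - real t + ln (real t) + 1"
  using assms
proof (induction t rule: nat_induct_non_zero)
  case (Suc t)
  have "ln (real t / real (Suc t)) \<le> real t / real (Suc t) - 1"
    using Suc.hyps by (intro ln_le_minus_one) simp
  then have "1 / real (Suc t) \<le> ln (real (Suc t)) - ln (real t)"
    using Suc.hyps by (simp add: ln_div field_simps)
  \<comment> \<open>This is exactly the slack that the induction step of this crude Stirling bound
    requires.\<close>
  then have "1 \<le> real (Suc t) * (ln (real (Suc t)) - ln (real t))"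
    by (simp add: field_simps)
  moreover have "ln (fact (Suc t) :: real) = ln (real (Suc t)) + ln (fact t)"
    by (simp add: ln_mult_pos del: of_nat_Suc)
  ultimately show ?case using Suc.IH by (simp add: algebra_simps)
qed auto

lemma exists_block_length:
  assumes "\<epsilon> > 0"
  shows "\<exists>t::nat. real t * ln 2 \<ge> 1 \<and>
    (2 ^ t) powr (2 + eta - \<epsilon>) \<le> (2 * (real t * ln 2 - 1)) ^ t / fact t"
proof -
  \<comment> \<open>A lower bound for the logarithm of the block factor to base
    \<open>2 ^ t\<close>, with \<open>ln (fact t)\<close> replaced by its Stirling bound.\<close>
  define g where "g t = (t * ln 2 + t * ln (t * ln 2 - 1) - (t * ln t - t + ln t + 1)) / (t * ln 2)"
    for t :: real
  have "(g \<longlongrightarrow> (ln 2 + ln (ln 2) + 1) * inverse (ln 2)) at_top"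
    unfolding g_def by real_asymp
  also have "(ln 2 + ln (ln 2) + 1) * inverse (ln 2) = 2 + eta"
    by (simp add: eta_def ln_div field_simps)
  finally have "((\<lambda>t. g (real t)) \<longlongrightarrow> 2 + eta) sequentially"
    by (rule filterlim_compose) (rule filterlim_real_sequentially)
  then have "\<forall>\<^sub>F t in sequentially. 2 + eta - \<epsilon> < g (real t)"
    by (rule order_tendstoD) (use assms in simp)
  moreover have "\<forall>\<^sub>F t in sequentially. real t * ln 2 > 1"
    by real_asymp
  ultimately have "\<forall>\<^sub>F t in sequentially. real t * ln 2 > 1 \<and> 2 + eta - \<epsilon> < g (real t) \<and> t > 0"
    using eventually_gt_at_top[of 0] by eventually_elim auto
  then obtain t :: nat where t: "1 < real t * ln 2" "2 + eta - \<epsilon> < g (real t)" "t > 0"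
    by (auto dest!: eventually_happens'[OF sequentially_bot])
  have "(2 + eta - \<epsilon>) * (t * ln 2) \<le> g t * (t * ln 2)"
    using t by (intro mult_right_mono) auto
  also have "\<dots> = t * ln 2 + t * ln (t * ln 2 - 1) - (t * ln t - t + ln t + 1)"
    using t by (simp add: g_def)
  also have "\<dots> \<le> t * ln 2 + t * ln (t * ln 2 - 1) - ln (fact t)"
    using ln_fact_le[OF t(3)] by simp
  also have "\<dots> = ln ((2 * (real t * ln 2 - 1)) ^ t / fact t)"
  proof -
    have "ln ((2 * x) ^ t / fact t) = t * (ln 2 + ln x) - ln (fact t)" if "x > 0" for x :: real
      using that by (simp add: ln_div ln_realpow ln_mult_pos distrib_left)
    from this[of "real t * ln 2 - 1"] t show ?thesis by (simp add: distrib_left)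
  qed
  finally have "exp ((2 + eta - \<epsilon>) * (t * ln 2)) \<le> (2 * (real t * ln 2 - 1)) ^ t / fact t"
    using t by (subst (asm) ln_ge_iff) auto
  moreover have "(2 ^ t) powr (2 + eta - \<epsilon>) = exp ((2 + eta - \<epsilon>) * (t * ln 2))"
    by (simp add: powr_def ln_realpow)
  ultimately show ?thesis using t by (intro exI[of _ t]) auto
qed

text \<open>The block length \<open>t\<close> is fixed by \<open>\<epsilon>\<close>, and as many
  blocks as fit below \<open>n\<close> are used. Their product is at least a constant times
  \<open>n powr (2 + eta - \<epsilon>)\<close>, and the loss \<open>n ^ 2\<close> leaves the
  exponent \<open>eta - \<epsilon>\<close>.\<close>

lemma (in prob_space) eventually_prob_sumset_ge:
  fixes X :: "nat \<Rightarrow> 'a \<Rightarrow> nat"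
  assumes indep: "indep_vars (\<lambda>_. count_space UNIV) X {1..}"
    and distr: "\<And>k. k \<ge> 1 \<Longrightarrow>
      distr M (count_space UNIV) (X k) = measure_pmf (poisson_pmf (1 / real k))"
    and \<epsilon>: "0 < \<epsilon>" "\<epsilon> \<le> 2 + eta"
  shows "\<exists>c>0. \<forall>\<^sub>F n in sequentially.
    c * real n powr (eta - \<epsilon>) \<le> prob {\<omega> \<in> space M. n \<in> sumset (\<lambda>k. X k \<omega>)}"
proof -
  define \<gamma> where "\<gamma> = 2 + eta - \<epsilon>"
  \<comment> \<open>Needed for monotonicity of \<open>powr\<close> in its base; hence the
    restriction \<open>\<epsilon> \<le> 2 + eta\<close>.\<close>
  have "\<gamma> \<ge> 0" using \<epsilon> by (simp add: \<gamma>_def)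
  obtain t :: nat where t: "real t * ln 2 \<ge> 1"
    "(2 ^ t) powr \<gamma> \<le> (2 * (real t * ln 2 - 1)) ^ t / fact t"
    using exists_block_length[OF \<epsilon>(1)] unfolding \<gamma>_def by blast
  have "t > 0" using t(1) by (cases t) auto
  \<comment> \<open>Chosen so that failure of the size condition at \<open>Suc j\<close> reads
    \<open>n < Q * (2 ^ t) ^ j\<close>.\<close>
  define Q where "Q = 4 * t * 2 ^ (2 * t)"
  have "Q > 0" using \<open>t > 0\<close> by (simp add: Q_def)
  have "exp (- 1) * (1 / real Q) powr \<gamma> * real n powr (eta - \<epsilon>) \<le>
      prob {\<omega> \<in> space M. n \<in> sumset (\<lambda>k. X k \<omega>)}" if n: "4 * t * 2 ^ t \<le> n" for n
  proof -
    have "0 < 4 * t * 2 ^ t" using \<open>t > 0\<close> by simp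
    then have "n > 0" using n by linarith
    define P where "P j \<longleftrightarrow> 4 * t * 2 ^ (t * (j + 1)) \<le> n" for j
    have bnd: "j \<le> n" if "P j" for j
    proof -
      have "j \<le> t * (j + 1)" using \<open>t > 0\<close> by (cases t) auto
      also have "\<dots> \<le> 2 ^ (t * (j + 1))" by (rule less_imp_le[OF less_exp])
      also have "\<dots> \<le> 4 * t * 2 ^ (t * (j + 1))" using \<open>t > 0\<close> by simp
      also have "\<dots> \<le> n" using that by (simp add: P_def)
      finally show ?thesis .
    qed
    \<comment> \<open>The largest admissible number of blocks; it exists since \<open>P 0\<close> is
      the assumption on \<open>n\<close> and \<open>P\<close> implies
      \<open>j \<le> n\<close>.\<close>
    define j where "j = (GREATEST j. P j)"
    have "P 0" using n by (simp add: P_def)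
    then have "P j" unfolding j_def using bnd by (rule GreatestI_nat)
    have "\<not> P (Suc j)"
      using Greatest_le_nat[of P "Suc j" n] bnd unfolding j_def by auto
    then have "n < 4 * t * 2 ^ (t * (Suc j + 1))" by (simp only: P_def not_le)
    also have "t * (Suc j + 1) = 2 * t + t * j" by simp
    also have "4 * t * 2 ^ (2 * t + t * j) = Q * (2 ^ t) ^ j"
      by (simp only: Q_def power_add power_mult mult.assoc)
    finally have "real n \<le> real (Q * (2 ^ t) ^ j)" by (intro of_nat_mono less_imp_le)
    then have "real n \<le> real Q * (2 ^ t) ^ j" by simp
    then have "(1 / real Q) * real n \<le> (2 ^ t) ^ j" using \<open>Q > 0\<close> by (simp add: field_simps)
    then have "((1 / real Q) * real n) powr \<gamma> \<le> ((2 ^ t) ^ j) powr \<gamma>"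
      using \<open>\<gamma> \<ge> 0\<close> by (intro powr_mono2) auto
    also have "\<dots> = ((2 ^ t) powr \<gamma>) ^ j"
      by (induction j) (simp_all add: powr_mult)
    also have "\<dots> \<le> ((2 * (real t * ln 2 - 1)) ^ t / fact t) ^ j"
      using t(2) by (intro power_mono) auto
    finally have le: "((1 / real Q) * real n) powr \<gamma> \<le> ((2 * (real t * ln 2 - 1)) ^ t / fact t) ^ j" .
    have "\<gamma> = (eta - \<epsilon>) + 2" by (simp add: \<gamma>_def)
    then have "real n powr \<gamma> = real n powr (eta - \<epsilon>) * real n ^ 2"
      using \<open>n > 0\<close> by (simp add: powr_add)
    moreover have "((1 / real Q) * real n) powr \<gamma> = (1 / real Q) powr \<gamma> * real n powr \<gamma>"
      by (rule powr_mult)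
    ultimately have "((1 / real Q) * real n) powr \<gamma> =
        (1 / real Q) powr \<gamma> * real n powr (eta - \<epsilon>) * real n ^ 2"
      by (simp only: mult.assoc)
    then have "exp (- 1) * (1 / real Q) powr \<gamma> * real n powr (eta - \<epsilon>) =
        exp (- 1) / real n ^ 2 * ((1 / real Q) * real n) powr \<gamma>"
      using \<open>n > 0\<close> by (simp only:) simp
    also have "\<dots> \<le> exp (- 1) / real n ^ 2 * ((2 * (real t * ln 2 - 1)) ^ t / fact t) ^ j"
      using le by (intro mult_left_mono) auto
    also have "\<dots> \<le> prob {\<omega> \<in> space M. n \<in> sumset (\<lambda>k. X k \<omega>)}"
      using \<open>P j\<close> unfolding P_def by (intro prob_sumset_ge_block indep distr t)
    finally show ?thesis .
  qed
  moreover have "exp (- 1) * (1 / real Q) powr \<gamma> > 0" using \<open>Q > 0\<close> by simp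
  ultimately show ?thesis
    unfolding eventually_sequentially by blast
qed

section \<open>Passage from the two bounds to the exponent\<close>

theorem theorem1p7:
  fixes M :: "'a measure" and X :: "nat \<Rightarrow> 'a \<Rightarrow> nat" and p :: "nat \<Rightarrow> real"
  assumes "prob_space M"
    and "prob_space.indep_vars M (\<lambda>_. count_space UNIV) X {1..}"
    and "\<And>k. k \<ge> 1 \<Longrightarrow>
      distr M (count_space UNIV) (X k) = measure_pmf (poisson_pmf (1 / real k))"
  defines "p \<equiv> \<lambda>n. measure M {\<omega> \<in> space M. n \<in> sumset (\<lambda>k. X k \<omega>)}"
  shows "\<exists>\<epsilon> :: nat \<Rightarrow> real. \<epsilon> \<longlonglongrightarrow> 0 \<and>
    (\<forall>\<^sub>F n in sequentially. p n = real n powr (eta + \<epsilon> n))"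
proof -
  interpret prob_space M by (rule assms(1))
  have upper: "p n \<le> (exp (1 / ln 2) + 1) * real n powr eta" if "n > 0" for n
    unfolding p_def using assms(2,3) that by (rule prob_sumset_le_powr_eta)
  \<comment> \<open>This gives \<open>2 + eta \<ge> 1\<close>, so the lower bound is available for
    every \<open>\<delta>\<close> up to 1.\<close>
  have eta: "eta > - 1"
  proof -
    have "- ln (ln 2) \<le> 1 / ln 2 - (1 :: real)"
      using ln_le_minus_one[of "1 / ln 2"] by (simp add: ln_div)
    also have "\<dots> < 1" using ln2_ge_two_thirds by (simp add: field_simps)
    finally show ?thesis by (simp add: eta_def ln_div field_simps)
  qed
  have lower: "\<exists>c>0. \<forall>\<^sub>F n in sequentially. c * real n powr (eta - \<delta>) \<le> p n"
    if "0 < \<delta>" "\<delta> \<le> 1" for \<delta>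
    unfolding p_def using assms(2,3) that(1) by (rule eventually_prob_sumset_ge) (use that eta in auto)
  \<comment> \<open>Positivity lets \<open>p n\<close> be written as a power of \<open>n\<close> by
    taking logarithms.\<close>
  have pos: "\<forall>\<^sub>F n in sequentially. p n > 0"
  proof -
    obtain c where "c > 0" and "\<forall>\<^sub>F n in sequentially. c * real n powr (eta - 1) \<le> p n"
      using lower[of 1] by auto
    from this(2) show ?thesis using eventually_gt_at_top[of 0]
    proof eventually_elim
      case (elim n)
      then have "0 < c * real n powr (eta - 1)" using \<open>c > 0\<close> by simp
      with elim show ?case by linarith
    qed
  qed
  \<comment> \<open>The exponent error solved from \<open>p n = n powr (eta + e n)\<close>, valid
    once \<open>p n > 0\<close> and \<open>n > 1\<close>.\<close>
  define e where "e n = ln (p n) / ln (real n) - eta" for n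
  have "e \<longlonglongrightarrow> 0"
  proof (rule order_tendstoI)
    fix a :: real assume "a < 0"
    \<comment> \<open>Half of \<open>- a\<close> leaves a gap between \<open>a\<close> and
      \<open>- \<delta>\<close> that absorbs the vanishing term \<open>ln c / ln n\<close>.\<close>
    define \<delta> where "\<delta> = min 1 (- a / 2)"
    have \<delta>: "0 < \<delta>" "\<delta> \<le> 1" "a < - \<delta>" using \<open>a < 0\<close> by (auto simp: \<delta>_def min_def)
    obtain c where "c > 0" and c: "\<forall>\<^sub>F n in sequentially. c * real n powr (eta - \<delta>) \<le> p n"
      using lower[OF \<delta>(1,2)] by auto
    have "((\<lambda>n. ln c / ln (real n) - \<delta>) \<longlongrightarrow> - \<delta>) sequentially" by real_asymp
    then have "\<forall>\<^sub>F n in sequentially. a < ln c / ln (real n) - \<delta>"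
      using \<delta>(3) by (rule order_tendstoD)
    then show "\<forall>\<^sub>F n in sequentially. a < e n"
      using c pos eventually_gt_at_top[of 1]
    proof eventually_elim
      case (elim n)
      have "ln c + (eta - \<delta>) * ln (real n) = ln (c * real n powr (eta - \<delta>))"
        using elim \<open>c > 0\<close> by (simp add: ln_mult_pos)
      also have "\<dots> \<le> ln (p n)" using elim \<open>c > 0\<close> by (subst ln_le_cancel_iff) auto
      finally have "(ln c + (eta - \<delta>) * ln (real n)) / ln (real n) \<le> ln (p n) / ln (real n)"
        using elim by (intro divide_right_mono) auto
      then have "ln c / ln (real n) - \<delta> \<le> e n"
        using elim by (simp add: e_def add_divide_distrib)
      then show ?case using elim by linarith
    qed
  next
    fix a :: real assume "a > 0"
    define c where "c = exp (1 / ln 2) + (1 :: real)"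
    have "c > 0" by (simp add: c_def add_pos_pos)
    have "((\<lambda>n. ln c / ln (real n)) \<longlongrightarrow> 0) sequentially" by real_asymp
    then have "\<forall>\<^sub>F n in sequentially. ln c / ln (real n) < a"
      using \<open>a > 0\<close> by (rule order_tendstoD)
    then show "\<forall>\<^sub>F n in sequentially. e n < a"
      using pos eventually_gt_at_top[of 1]
    proof eventually_elim
      case (elim n)
      have "ln (p n) \<le> ln (c * real n powr eta)"
        using elim upper[of n] \<open>c > 0\<close> by (subst ln_le_cancel_iff) (auto simp: c_def)
      also have "\<dots> = ln c + eta * ln (real n)"
        using elim \<open>c > 0\<close> by (simp add: ln_mult_pos)
      finally have "ln (p n) / ln (real n) \<le> (ln c + eta * ln (real n)) / ln (real n)"
        using elim by (intro divide_right_mono) auto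
      then have "e n \<le> ln c / ln (real n)"
        using elim by (simp add: e_def add_divide_distrib)
      then show ?case using elim by linarith
    qed
  qed
  moreover have "\<forall>\<^sub>F n in sequentially. p n = real n powr (eta + e n)"
    using pos eventually_gt_at_top[of 1]
    by eventually_elim (simp add: e_def powr_def)
  ultimately show ?thesis by blast
qed

end
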